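(* Let $(X,\Sigma,\mu)$ be a complete, $\sigma$-finite measure space and let $\ell$ be a von Neumann lifting of $\mu$. Let $\mathbb B$ be a Banach space having the Radon–Nikodým property. Let $\Omega$ be any $\mathbb B$-valued measure on $(X,\Sigma)$ having bounded variation and satisfying $\Omega\ll\mu$. Then $$\frac{d\Omega}{d\mu}(x)=\lim_{I\Rightarrow x}\frac{\Omega(I)}{\mu(I)}\in\mathbb B,\qquad\text{for }\mu\text{-a.e. }x\in X,$$ where the limit is the $\mathcal I^\ell$-limit in the norm topology of $\mathbb B$.
   Context: Von Neumann lifting: for a measure space $(X,\Sigma,\mu)$ with $\mu\neq 0$, a map $\ell\colon\Sigma\to\Sigma$ is a von Neumann lifting of $\mu$ if (i) $\ell(\varnothing)=\varnothing$, $\ell(X)=X$, $\ell(E\cap F)=\ell(E)\cap\ell(F)$ and $\ell(E\cup F)=\ell(E)\cup\ell(F)$ for all $E,F\in\Sigma$; (ii) $\ell(E)=\ell(F)$ whenever $\mu(E\Delta F)=0$; (iii) $\mu(E\Delta\ell(E))=0$ for every $E\in\Sigma$. Induced differentiation basis: $\mathcal I^\ell:=\{\ell(E): E\in\Sigma,\ 0<\mu(E)<+\infty\}$. For $x\in X$, $\mathcal I^\ell_x:=\{I\in\mathcal I^\ell: x\in I\}$; this is non-empty for $\mu$-a.e. $x$. For a map $\Phi$ from $\mathcal I^\ell$ to a Hausdorff space and $x$ with $\mathcal I^\ell_x\neq\varnothing$, $\lim_{I\Rightarrow x}\Phi(I)=z$ means: for every open neighbourhood $U$ of $z$ there is $I\in\mathcal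 I^\ell_x$ such that $\Phi(J)\in U$ for every $J\in\mathcal I^\ell_x$ with $J\subset I$. A $\mathbb B$-valued measure on $(X,\Sigma)$ is a map $\Omega\colon\Sigma\to\mathbb B$ that is countably additive in norm. Its variation is $\|\Omega\|_{\mathbb B}(E):=\sup\sum_{i=1}^n\|\Omega(E_i)\|_{\mathbb B}$ over finite measurable partitions $(E_i)_{i=1}^n$ of $E$; $\Omega$ has bounded variation if $\|\Omega\|_{\mathbb B}(X)<+\infty$. $\Omega\ll\mu$ means $\Omega(N)=0$ whenever $N\in\Sigma$, $\mu(N)=0$. $\mathbb B$ has the Radon–Nikodým property if for every $\sigma$-finite measure space $(X,\Sigma,\mu)$ and every $\mathbb B$-valued measure $\Omega$ on $(X,\Sigma)$ of bounded variation with $\Omega\ll\mu$ there exists a (necessarily unique) element $\frac{d\Omega}{d\mu}\in L^1(\mu;\mathbb B)$ (the Lebesgue–Bochner space), called the Radon–Nikodým derivative, such that $\Omega(E)=\int_E\frac{d\Omega}{d\mu}\,d\mu$ (Bochner integral) for every $E\in\Sigma$. *)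

theory Defs
  imports "HOL-Analysis.Analysis"
begin

section \<open>Von Neumann liftings and the induced differentiation basis\<close>

definition von_Neumann_lifting :: "'a measure \<Rightarrow> ('a set \<Rightarrow> 'a set) \<Rightarrow> bool" where
  "von_Neumann_lifting M l \<longleftrightarrow>
     emeasure M (space M) \<noteq> 0 \<and>
     l \<in> sets M \<rightarrow> sets M \<and>
     l {} = {} \<and> l (space M) = space M \<and>
     (\<forall>E\<in>sets M. \<forall>F\<in>sets M. l (E \<inter> F) = l E \<inter> l F \<and> l (E \<union> F) = l E \<union> l F) \<and>
     (\<forall>E\<in>sets M. \<forall>F\<in>sets M. emeasure M (sym_diff E F) = 0 \<longrightarrow> l E = l F) \<and>
     (\<forall>E\<in>sets M. emeasure M (sym_diff E (l E)) = 0)"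

definition lifting_basis :: "'a measure \<Rightarrow> ('a set \<Rightarrow> 'a set) \<Rightarrow> 'a set set" where
  "lifting_basis M l = {l E | E. E \<in> sets M \<and> 0 < emeasure M E \<and> emeasure M E < \<infinity>}"

text \<open>
  The convergence \<open>\<Phi>(I) \<rightarrow> z\<close> as \<open>I \<Rightarrow> x\<close> along the members of a family \<open>\<I>\<close> that contain \<open>x\<close>.
  Taking \<open>U = UNIV\<close> shows that it entails that some member of \<open>\<I>\<close> contains \<open>x\<close>.
\<close>

definition has_basis_limit ::
  "'a set set \<Rightarrow> ('a set \<Rightarrow> 'b::t2_space) \<Rightarrow> 'a \<Rightarrow> 'b \<Rightarrow> bool" where
  "has_basis_limit \<I> \<Phi> x z \<longleftrightarrow>
     (\<forall>U. open U \<and> z \<in> U \<longrightarrow>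
        (\<exists>I\<in>\<I>. x \<in> I \<and> (\<forall>J\<in>\<I>. x \<in> J \<and> J \<subseteq> I \<longrightarrow> \<Phi> J \<in> U)))"


section \<open>Banach-valued measures\<close>

text \<open>Values of \<open>\<Omega>\<close> outside \<open>sets M\<close> are irrelevant.\<close>

definition vector_valued_measure :: "'a measure \<Rightarrow> ('a set \<Rightarrow> 'b::real_normed_vector) \<Rightarrow> bool" where
  "vector_valued_measure M \<Omega> \<longleftrightarrow>
     (\<forall>A. range A \<subseteq> sets M \<and> disjoint_family A \<longrightarrow>
        (\<lambda>n::nat. \<Omega> (A n)) sums \<Omega> (\<Union>n. A n))"

definition variation :: "'a measure \<Rightarrow> ('a set \<Rightarrow> 'b::real_normed_vector) \<Rightarrow> 'a set \<Rightarrow> ennreal" where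
  "variation M \<Omega> E =
     Sup {\<Sum>i<n. ennreal (norm (\<Omega> (A i))) | (n::nat) A.
            (\<forall>i<n. A i \<in> sets M) \<and> disjoint_family_on A {..<n} \<and> (\<Union>i<n. A i) = E}"

definition bounded_variation :: "'a measure \<Rightarrow> ('a set \<Rightarrow> 'b::real_normed_vector) \<Rightarrow> bool" where
  "bounded_variation M \<Omega> \<longleftrightarrow> variation M \<Omega> (space M) < \<infinity>"

definition abs_cont :: "'a measure \<Rightarrow> ('a set \<Rightarrow> 'b::real_normed_vector) \<Rightarrow> bool" where
  "abs_cont M \<Omega> \<longleftrightarrow> (\<forall>N\<in>sets M. emeasure M N = 0 \<longrightarrow> \<Omega> N = 0)"


section \<open>The Bochner integral in an arbitrary Banach space\<close>

text \<open>
  The library's \<^const>\<open>has_bochner_integral\<close> is restricted to second countable, i.e. separable,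
  target spaces. The definition below drops this restriction by replacing Borel measurability
  by strong measurability, i.e. by being a pointwise limit of simple functions. Lemma
  \<open>has_bochner_integral'_iff\<close> shows the agreement with the library on separable spaces.
\<close>

definition strongly_measurable :: "'a measure \<Rightarrow> ('a \<Rightarrow> 'b::real_normed_vector) \<Rightarrow> bool" where
  "strongly_measurable M f \<longleftrightarrow>
     (\<exists>s. (\<forall>i::nat. simple_function M (s i)) \<and> (\<forall>x\<in>space M. (\<lambda>i. s i x) \<longlonglongrightarrow> f x))"

definition has_bochner_integral' ::
  "'a measure \<Rightarrow> ('a \<Rightarrow> 'b::real_normed_vector) \<Rightarrow> 'b \<Rightarrow> bool" where
  "has_bochner_integral' M f z \<longleftrightarrow>
     strongly_measurable M f \<and>
     (\<exists>s. (\<forall>i::nat. Bochner_Integration.simple_bochner_integrable M (s i)) \<and>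
          (\<lambda>i. \<integral>\<^sup>+x. norm (f x - s i x) \<partial>M) \<longlonglongrightarrow> 0 \<and>
          (\<lambda>i. Bochner_Integration.simple_bochner_integral M (s i)) \<longlonglongrightarrow> z)"

lemma has_bochner_integral'_iff:
  fixes f :: "'a \<Rightarrow> 'b::{real_normed_vector, second_countable_topology}"
  shows "has_bochner_integral' M f z \<longleftrightarrow> has_bochner_integral M f z"
proof -
  have meas: "strongly_measurable M f \<longleftrightarrow> f \<in> borel_measurable M"
  proof
    assume "strongly_measurable M f"
    then obtain s where s: "\<forall>i::nat. simple_function M (s i)"
      and lim: "\<forall>x\<in>space M. (\<lambda>i. s i x) \<longlonglongrightarrow> f x"
      unfolding strongly_measurable_def by (elim exE conjE)
    show "f \<in> borel_measurable M"
    proof (rule borel_measurable_LIMSEQ_metric)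
      show "s i \<in> borel_measurable M" for i
        by (rule borel_measurable_simple_function) (rule s[rule_format])
      show "(\<lambda>i. s i x) \<longlonglongrightarrow> f x" if "x \<in> space M" for x
        using lim that by (rule bspec)
    qed
  next
    assume "f \<in> borel_measurable M"
    from borel_measurable_implies_sequence_metric[OF this, of 0]
    show "strongly_measurable M f"
      unfolding strongly_measurable_def by (elim exE conjE) (intro exI conjI)
  qed
  show ?thesis
    unfolding has_bochner_integral'_def has_bochner_integral.simps meas by simp
qed


section \<open>Radon--Nikodym derivatives and the Radon--Nikodym property\<close>

text \<open>\<open>f\<close> is a representative of the element of \<open>L\<^sup>1(M; 'b)\<close> that is the density of \<open>\<Omega>\<close>.\<close>

definition is_RN_derivative ::
  "'a measure \<Rightarrow> ('a set \<Rightarrow> 'b::real_normed_vector) \<Rightarrow> ('a \<Rightarrow> 'b) \<Rightarrow> bool" where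
  "is_RN_derivative M \<Omega> f \<longleftrightarrow>
     (\<exists>z. has_bochner_integral' M f z) \<and>
     (\<forall>E\<in>sets M. has_bochner_integral' M (\<lambda>x. indicator E x *\<^sub>R f x) (\<Omega> E))"

text \<open>
  HOL cannot quantify over types inside a formula, so the property is relative to the type \<open>'a\<close>
  that carries the measure spaces; all \<open>\<sigma>\<close>-finite measure spaces on subsets of \<open>'a\<close> are covered. As a hypothesis
  about \<open>'b\<close> it is implied, for every \<open>'a\<close>, by the Radon--Nikodym property in the usual sense.
\<close>

definition Radon_Nikodym_property :: "'a itself \<Rightarrow> 'b::banach itself \<Rightarrow> bool" where
  "Radon_Nikodym_property _ _ \<longleftrightarrow>
     (\<forall>(M :: 'a measure) (\<Omega> :: 'a set \<Rightarrow> 'b).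
        sigma_finite_measure M \<and> vector_valued_measure M \<Omega> \<and>
        bounded_variation M \<Omega> \<and> abs_cont M \<Omega> \<longrightarrow>
        (\<exists>f. is_RN_derivative M \<Omega> f))"

end

theory Submission
  imports Defs
begin

text \<open>
  The values of a density \<open>f\<close> lie in the closure of a countable set \<open>D\<close>. For \<open>d \<in> D\<close> and \<open>r > 0\<close>, almost
  every point of \<open>E = {x. \<parallel>f x - d\<parallel> < r}\<close> (cut down to finite measure) lies in \<open>l E\<close>, and on every
  \<open>J \<subseteq> l E\<close> of positive finite measure the average \<open>\<Omega> J / \<mu> J\<close> of \<open>f\<close> is within \<open>r\<close> of \<open>d\<close>. Countably many
  triples \<open>(d, r, X\<^sub>n)\<close> suffice, so a single null set can be discarded.
\<close>

section \<open>Strong measurability with values in a possibly non-separable space\<close>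

text \<open>Taking norms reduces everything to real functions: those of \<open>s i x - h x\<close>
  are simple and converge pointwise. This supplies the measurability used both for adding
  nonnegative integrals and for the sets \<open>E d k n\<close> below.\<close>

lemma strongly_measurable_norm_diff:
  fixes g :: "'a \<Rightarrow> 'b::real_normed_vector"
  assumes "strongly_measurable M g" and h: "simple_function M h"
  shows "(\<lambda>x. norm (g x - h x)) \<in> borel_measurable M"
proof -
  obtain s where s: "\<And>i::nat. simple_function M (s i)"
    and lim: "\<And>x. x \<in> space M \<Longrightarrow> (\<lambda>i. s i x) \<longlonglongrightarrow> g x"
    using assms(1) unfolding strongly_measurable_def by blast
  show ?thesis
  proof (rule borel_measurable_LIMSEQ_real)
    show "(\<lambda>i. norm (s i x - h x)) \<longlonglongrightarrow> norm (g x - h x)" if "x \<in> space M" for x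
      by (intro tendsto_intros lim that)
    show "(\<lambda>x. norm (s i x - h x)) \<in> borel_measurable M" for i
      by (rule borel_measurable_simple_function)
        (rule simple_function_compose2[OF s h])
  qed
qed

text \<open>A simple function has finite range, so all values of an approximating sequence together
  form a countable set. It stands in for separability of the target space.\<close>

lemma strongly_measurable_countable_approx:
  fixes g :: "'a \<Rightarrow> 'b::real_normed_vector"
  assumes "strongly_measurable M g"
  obtains D where "countable D" and "\<And>x e. x \<in> space M \<Longrightarrow> e > 0 \<Longrightarrow> \<exists>d\<in>D. norm (g x - d) < e"
proof -
  obtain s where s: "\<And>i::nat. simple_function M (s i)"
    and lim: "\<And>x. x \<in> space M \<Longrightarrow> (\<lambda>i. s i x) \<longlonglongrightarrow> g x"
    using assms unfolding strongly_measurable_def by blast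
  show thesis
  proof (rule that)
    show "countable (\<Union>i. s i ` space M)"
      using s by (auto intro: countable_finite simple_functionD)
    fix x e assume x: "x \<in> space M" and e: "(e::real) > 0"
    obtain i where "norm (s i x - g x) < e"
      using LIMSEQ_D[OF lim[OF x] e] by blast
    then show "\<exists>d\<in>\<Union>i. s i ` space M. norm (g x - d) < e"
      using x by (auto simp: norm_minus_commute)
  qed
qed

section \<open>Norm estimates for the Bochner integral\<close>

lemma norm_simple_bochner_integral_le:
  fixes h :: "'a \<Rightarrow> 'b::real_normed_vector"
  assumes "Bochner_Integration.simple_bochner_integrable M h"
  shows "ennreal (norm (Bochner_Integration.simple_bochner_integral M h)) \<le> (\<integral>\<^sup>+x. norm (h x) \<partial>M)"
proof -
  have "Bochner_Integration.simple_bochner_integrable M (\<lambda>x. norm (h x))"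
    using Bochner_Integration.simple_bochner_integrable_compose2[of "\<lambda>x y. norm x", OF _ assms assms]
    by simp
  then show ?thesis
    using Bochner_Integration.simple_bochner_integral_norm_bound[OF assms]
    by (subst Bochner_Integration.simple_bochner_integral_eq_nn_integral[symmetric])
      (auto intro: ennreal_leI)
qed

text \<open>Going through \<open>g\<close>, the triangle inequality bounds the distance between the
  integrals of \<open>s i\<close> and \<open>h\<close> by two nonnegative integrals. The first tends
  to 0, and passing to the limit in \<open>i\<close> leaves the claim.\<close>

lemma has_bochner_integral'_norm_diff_le:
  fixes g :: "'a \<Rightarrow> 'b::real_normed_vector"
  assumes g: "has_bochner_integral' M g z"
    and h: "Bochner_Integration.simple_bochner_integrable M h"
  shows "ennreal (norm (z - Bochner_Integration.simple_bochner_integral M h)) \<le>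
    (\<integral>\<^sup>+x. norm (g x - h x) \<partial>M)"
proof -
  obtain s where s: "\<And>i::nat. Bochner_Integration.simple_bochner_integrable M (s i)"
    and lim0: "(\<lambda>i. \<integral>\<^sup>+x. norm (g x - s i x) \<partial>M) \<longlonglongrightarrow> 0"
    and limz: "(\<lambda>i. Bochner_Integration.simple_bochner_integral M (s i)) \<longlonglongrightarrow> z"
    and meas: "strongly_measurable M g"
    using g unfolding has_bochner_integral'_def by blast
  have simple: "simple_function M (s i)" "simple_function M h" for i
    using s h by (auto elim: Bochner_Integration.simple_bochner_integrable.cases)
  have [measurable]: "(\<lambda>x. norm (g x - s i x)) \<in> borel_measurable M"
    "(\<lambda>x. norm (g x - h x)) \<in> borel_measurable M" for i
    by (intro strongly_measurable_norm_diff meas simple)+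
  have "ennreal (norm (Bochner_Integration.simple_bochner_integral M (s i)
        - Bochner_Integration.simple_bochner_integral M h)) \<le>
      (\<integral>\<^sup>+x. norm (g x - s i x) \<partial>M) + (\<integral>\<^sup>+x. norm (g x - h x) \<partial>M)" for i
  proof -
    have "ennreal (norm (Bochner_Integration.simple_bochner_integral M (s i)
        - Bochner_Integration.simple_bochner_integral M h)) \<le> (\<integral>\<^sup>+x. norm (s i x - h x) \<partial>M)"
      using norm_simple_bochner_integral_le[of M "\<lambda>x. s i x - h x"] s h
      by (simp add: Bochner_Integration.simple_bochner_integral_diff
          Bochner_Integration.simple_bochner_integrable_compose2[where p="(-)"])
    also have "\<dots> \<le> (\<integral>\<^sup>+x. ennreal (norm (g x - s i x)) + ennreal (norm (g x - h x)) \<partial>M)"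
    proof (rule nn_integral_mono)
      fix x
      have "norm (s i x - h x) \<le> norm (g x - s i x) + norm (g x - h x)"
        using norm_triangle_ineq4[of "g x - h x" "g x - s i x"] by (simp add: algebra_simps)
      then show "ennreal (norm (s i x - h x)) \<le> ennreal (norm (g x - s i x)) + ennreal (norm (g x - h x))"
        by (simp flip: ennreal_plus add: ennreal_leI)
    qed
    also have "\<dots> = (\<integral>\<^sup>+x. norm (g x - s i x) \<partial>M) + (\<integral>\<^sup>+x. norm (g x - h x) \<partial>M)"
      by (rule nn_integral_add) measurable
    finally show ?thesis .
  qed
  moreover have "(\<lambda>i. ennreal (norm (Bochner_Integration.simple_bochner_integral M (s i)
        - Bochner_Integration.simple_bochner_integral M h)))
      \<longlonglongrightarrow> ennreal (norm (z - Bochner_Integration.simple_bochner_integral M h))"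
    by (intro tendsto_intros limz)
  moreover have "(\<lambda>i. (\<integral>\<^sup>+x. norm (g x - s i x) \<partial>M) + (\<integral>\<^sup>+x. norm (g x - h x) \<partial>M))
      \<longlonglongrightarrow> 0 + (\<integral>\<^sup>+x. norm (g x - h x) \<partial>M)"
    by (intro tendsto_intros lim0)
  ultimately show ?thesis
    using LIMSEQ_le[of _ "ennreal (norm (z - Bochner_Integration.simple_bochner_integral M h))"]
    by fastforce
qed

lemma simple_bochner_indicator:
  fixes d :: "'b::real_normed_vector"
  assumes J: "J \<in> sets M" "emeasure M J < \<infinity>"
  shows "Bochner_Integration.simple_bochner_integrable M (\<lambda>x. indicator J x *\<^sub>R d)"
    and "Bochner_Integration.simple_bochner_integral M (\<lambda>x. indicator J x *\<^sub>R d) = measure M J *\<^sub>R d"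
proof -
  have sf: "simple_function M (indicator J :: 'a \<Rightarrow> real)"
    using J(1) by (rule simple_function_indicator)
  have sub: "emeasure M {y\<in>space M. indicat_real J y \<noteq> 0} \<noteq> \<infinity>"
    using J sets.sets_into_space[OF J(1)]
    by (auto simp: indicator_def Int_absorb1 Collect_conj_eq)
  have int: "Bochner_Integration.simple_bochner_integrable M (indicator J :: 'a \<Rightarrow> real)"
    using sf sub by (rule Bochner_Integration.simple_bochner_integrable.intros)
  then show "Bochner_Integration.simple_bochner_integrable M (\<lambda>x. indicator J x *\<^sub>R d)"
    using Bochner_Integration.simple_bochner_integrable_compose2[of "\<lambda>x y. x *\<^sub>R d", OF _ int int]
    by simp
  \<comment> \<open>The real integral is read off from the nonnegative one; \<open>d\<close> then
    enters through the linear map sending a real \<open>x\<close> to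
    \<open>x *\<^sub>R d\<close>.\<close>
  have "ennreal (Bochner_Integration.simple_bochner_integral M (indicator J)) =
      (\<integral>\<^sup>+x. indicator J x \<partial>M)"
    using int
    by (subst Bochner_Integration.simple_bochner_integral_eq_nn_integral) (auto simp: ennreal_indicator)
  also have "\<dots> = ennreal (measure M J)"
    using J by (simp add: emeasure_eq_ennreal_measure)
  finally have "Bochner_Integration.simple_bochner_integral M (indicator J) = measure M J"
    by simp
  then show "Bochner_Integration.simple_bochner_integral M (\<lambda>x. indicator J x *\<^sub>R d) = measure M J *\<^sub>R d"
    using Bochner_Integration.simple_bochner_integral_linear[OF _ int, of "\<lambda>x. x *\<^sub>R d"]
    by (simp add: linear_iff scaleR_add_left)
qed

text \<open>Comparing \<open>f\<close> on \<open>J\<close> with the constant \<open>d\<close> bounds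
  the norm of \<open>\<Omega> J - measure M J *\<^sub>R d\<close> by \<open>r * measure M J\<close>;
  then divide by the measure. The hypothesis \<open>near\<close> is only almost everywhere because a
  subset of \<open>l E\<close> lies in \<open>E\<close> only up to a null set.\<close>

lemma RN_derivative_average_bound:
  fixes f :: "'a \<Rightarrow> 'b::real_normed_vector"
  assumes f: "is_RN_derivative M \<Omega> f"
    and J: "J \<in> sets M" "0 < emeasure M J" "emeasure M J < \<infinity>"
    and near: "AE x in M. x \<in> J \<longrightarrow> norm (f x - d) \<le> r" and r: "0 \<le> r"
  shows "norm (\<Omega> J /\<^sub>R measure M J - d) \<le> r"
proof -
  have pos: "measure M J > 0"
    using J by (simp add: emeasure_eq_ennreal_measure)
  have "has_bochner_integral' M (\<lambda>x. indicator J x *\<^sub>R f x) (\<Omega> J)"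
    using f J unfolding is_RN_derivative_def by blast
  from has_bochner_integral'_norm_diff_le[OF this simple_bochner_indicator(1)[OF J(1,3), of d]]
  have "ennreal (norm (\<Omega> J - measure M J *\<^sub>R d)) \<le>
      (\<integral>\<^sup>+x. norm (indicator J x *\<^sub>R f x - indicator J x *\<^sub>R d) \<partial>M)"
    by (simp add: simple_bochner_indicator(2)[OF J(1,3)])
  also have "\<dots> \<le> (\<integral>\<^sup>+x. ennreal r * indicator J x \<partial>M)"
    using near by (intro nn_integral_mono_AE, eventually_elim) (auto simp: indicator_def ennreal_leI)
  also have "\<dots> = ennreal (r * measure M J)"
    using J r by (simp add: nn_integral_cmult_indicator emeasure_eq_ennreal_measure ennreal_mult)
  finally have le: "norm (\<Omega> J - measure M J *\<^sub>R d) \<le> r * measure M J"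
    using r by simp
  have "\<Omega> J /\<^sub>R measure M J - d = (\<Omega> J - measure M J *\<^sub>R d) /\<^sub>R measure M J"
    using pos by (simp add: scaleR_diff_right)
  then have "norm (\<Omega> J /\<^sub>R measure M J - d) = norm (\<Omega> J - measure M J *\<^sub>R d) / measure M J"
    using pos by (simp add: divide_inverse_commute)
  then show ?thesis
    using le pos by (simp add: divide_le_eq)
qed

section \<open>Liftings and null sets\<close>

lemma von_Neumann_lifting_sets:
  assumes "von_Neumann_lifting M l" and "E \<in> sets M"
  shows "l E \<in> sets M"
  using assms unfolding von_Neumann_lifting_def by (elim conjE) (rule funcset_mem)

lemma von_Neumann_lifting_AE:
  assumes "von_Neumann_lifting M l" and E: "E \<in> sets M"
  shows "AE x in M. x \<in> E \<longleftrightarrow> x \<in> l E"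
proof (rule AE_I')
  have "emeasure M (sym_diff E (l E)) = 0"
    using assms unfolding von_Neumann_lifting_def by blast
  then show "sym_diff E (l E) \<in> null_sets M"
    using E von_Neumann_lifting_sets[OF assms] by auto
qed auto

lemma von_Neumann_lifting_emeasure:
  assumes l: "von_Neumann_lifting M l" and E: "E \<in> sets M"
  shows "emeasure M (l E) = emeasure M E"
  using von_Neumann_lifting_AE[OF assms] E von_Neumann_lifting_sets[OF assms]
  by (intro emeasure_eq_AE) auto

text \<open>A null set is equivalent to the empty set. Used contrapositively: a point of
  \<open>l E\<close> forces \<open>E\<close> to have positive measure, as membership of
  \<open>l E\<close> in the basis requires.\<close>

lemma von_Neumann_lifting_null:
  assumes "von_Neumann_lifting M l" and "E \<in> sets M" and "emeasure M E = 0"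
  shows "l E = {}"
proof -
  have "emeasure M (sym_diff E {}) = 0"
    using assms by simp
  then show ?thesis
    using assms unfolding von_Neumann_lifting_def by (metis sets.empty_sets)
qed

section \<open>Convergence of the averages along the basis\<close>

lemma RN_derivative_basis_limit:
  fixes f :: "'a \<Rightarrow> 'b::real_normed_vector"
  assumes sf: "sigma_finite_measure M" and l: "von_Neumann_lifting M l" and f: "is_RN_derivative M \<Omega> f"
  shows "AE x in M. has_basis_limit (lifting_basis M l) (\<lambda>I. \<Omega> I /\<^sub>R measure M I) x (f x)"
proof -
  have fm: "strongly_measurable M f"
    using f unfolding is_RN_derivative_def has_bochner_integral'_def by blast
  obtain D where D: "countable D"
    and dense: "\<And>x e. x \<in> space M \<Longrightarrow> e > 0 \<Longrightarrow> \<exists>d\<in>D. norm (f x - d) < e"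
    using strongly_measurable_countable_approx[OF fm] by blast
  obtain A :: "nat \<Rightarrow> 'a set" where A: "range A \<subseteq> sets M" "(\<Union>n. A n) = space M"
    "\<And>n. emeasure M (A n) \<noteq> \<infinity>"
    using sigma_finite_measure.sigma_finite[OF sf] by blast
  \<comment> \<open>Intersecting with \<open>A n\<close> makes the measure finite, so that
    \<open>l (E d k n)\<close> can belong to the basis; the radii 1/(k+1) replace arbitrary r > 0 by
    countably many.\<close>
  define E where "E d k n = {x \<in> space M. norm (f x - d) < 1 / real (Suc k)} \<inter> A n" for d k n
  have E: "E d k n \<in> sets M" for d k n
  proof -
    have [measurable]: "A n \<in> sets M" "(\<lambda>x. norm (f x - d)) \<in> borel_measurable M"
      using A(1) strongly_measurable_norm_diff[OF fm, of "\<lambda>_. d"] by auto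
    show ?thesis
      unfolding E_def by measurable
  qed
  \<comment> \<open>Countability of \<open>D\<close> lets the quantifiers move inside, so the
    exceptional null set is fixed before any neighbourhood \<open>U\<close> is chosen.\<close>
  have "AE x in M. \<forall>d\<in>D. \<forall>k n. x \<in> E d k n \<longleftrightarrow> x \<in> l (E d k n)"
    unfolding AE_ball_countable[OF D] AE_all_countable
    using von_Neumann_lifting_AE[OF l E] by blast
  then show ?thesis
    using AE_space
  proof eventually_elim
    case (elim x)
    show ?case
      unfolding has_basis_limit_def
    proof (intro allI impI)
      fix U assume "open U \<and> f x \<in> U"
      then obtain e where e: "e > 0" "ball (f x) e \<subseteq> U"
        using open_contains_ball by blast
      \<comment> \<open>Half of \<open>e\<close> is for the distance from \<open>f x\<close> to
        \<open>d\<close>, the other half for the distance from \<open>d\<close> to the average over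
        \<open>J\<close>.\<close>
      obtain k where k: "1 / real (Suc k) < e / 2"
        using e(1) nat_approx_posE[of "e/2"] by auto
      obtain d where d: "d \<in> D" "norm (f x - d) < 1 / real (Suc k)"
        using dense[OF elim(2), of "1 / real (Suc k)"] by auto
      obtain n where n: "x \<in> A n"
        using A(2) elim(2) by blast
      let ?E = "E d k n"
      have xE: "x \<in> l ?E"
        using elim d n by (auto simp: E_def)
      have "emeasure M ?E \<noteq> 0"
        using von_Neumann_lifting_null[OF l E] xE by fastforce
      moreover have "emeasure M ?E < \<infinity>"
      proof -
        have "emeasure M ?E \<le> emeasure M (A n)"
          using A(1) by (intro emeasure_mono) (auto simp: E_def)
        then show ?thesis
          using A(3)[of n] by (simp add: less_top top_unique order.strict_trans1)
      qed
      ultimately have "l ?E \<in> lifting_basis M l"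
        using E unfolding lifting_basis_def by (auto simp: zero_less_iff_neq_zero)
      moreover have "\<Omega> J /\<^sub>R measure M J \<in> U"
        if J: "J \<in> lifting_basis M l" "J \<subseteq> l ?E" for J
      proof -
        obtain G where G: "G \<in> sets M" "0 < emeasure M G" "emeasure M G < \<infinity>" "J = l G"
          using J(1) unfolding lifting_basis_def by blast
        have Jm: "J \<in> sets M"
          using von_Neumann_lifting_sets[OF l G(1)] G(4) by simp
        have Je: "emeasure M J = emeasure M G"
          using von_Neumann_lifting_emeasure[OF l G(1)] G(4) by simp
        \<comment> \<open>Almost every point of \<open>J\<close> lies in \<open>?E\<close>, since
          \<open>J\<close> is contained in \<open>l ?E\<close>, and there \<open>f\<close> is close
          to \<open>d\<close> by construction.\<close>
        have "AE y in M. y \<in> J \<longrightarrow> norm (f y - d) \<le> 1 / real (Suc k)"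
          using von_Neumann_lifting_AE[OF l E, of d k n]
          by eventually_elim (use J(2) in \<open>auto simp: E_def\<close>)
        then have "norm (\<Omega> J /\<^sub>R measure M J - d) \<le> 1 / real (Suc k)"
          using G Je Jm by (intro RN_derivative_average_bound[OF f]) auto
        then have "norm (f x - \<Omega> J /\<^sub>R measure M J) < e"
          using norm_triangle_ineq4[of "f x - d" "\<Omega> J /\<^sub>R measure M J - d"] d(2) k by simp
        then show ?thesis
          using e(2) by (auto simp: dist_norm)
      qed
      ultimately show "\<exists>I\<in>lifting_basis M l. x \<in> I \<and>
          (\<forall>J\<in>lifting_basis M l. x \<in> J \<and> J \<subseteq> I \<longrightarrow> \<Omega> J /\<^sub>R measure M J \<in> U)"
        using xE by blast
    qed
  qed
qed

text \<open>The derivative is a class modulo null sets, so the limit is asserted for every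
  representative and existence is stated separately. Existence is the Radon-Nikodym property
  instantiated at \<open>M\<close> and \<open>\<Omega>\<close>.\<close>

theorem corollary3p6:
  fixes M :: "'a measure"
    and l :: "'a set \<Rightarrow> 'a set"
    and \<Omega> :: "'a set \<Rightarrow> 'b::banach"
  assumes "complete_measure M"
    and "sigma_finite_measure M"
    and "von_Neumann_lifting M l"
    and "Radon_Nikodym_property TYPE('a) TYPE('b)"
    and "vector_valued_measure M \<Omega>"
    and "bounded_variation M \<Omega>"
    and "abs_cont M \<Omega>"
  shows "(\<exists>f. is_RN_derivative M \<Omega> f) \<and>
    (\<forall>f. is_RN_derivative M \<Omega> f \<longrightarrow>
      (AE x in M. has_basis_limit (lifting_basis M l) (\<lambda>I. \<Omega> I /\<^sub>R measure M I) x (f x)))"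
  using assms RN_derivative_basis_limit[of M l \<Omega>]
  unfolding Radon_Nikodym_property_def by blast

end
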